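(* Let $m$ and $n$ be positive integers and let $I=\{m\}$. Then $$\begin{aligned} dd(I;n+1) = {}& \left(\sum_{k=m+1}^{n}\binom{n}{k}\, dd(I;k)\, b_{n-k}\right) \\ &+ \binom{n}{m-2}\, dd(\emptyset;m-2)\,\bigl(dd(\emptyset;n-m+2)-b_{n-m+2}\bigr) \\ &+ \left(\sum_{k=0}^{m-4}\binom{n}{k}\, dd(\emptyset;k)\, c(\{m-1-k\};n-k)\right). \end{aligned}$$
   Context: Let $\mathfrak{S}_n$ be the set of permutations $w=[w_1,\dots,w_n]$ of $\{1,\dots,n\}$ (one-line notation; $\mathfrak S_0$ consists of the empty permutation). A double descent of $w\in\mathfrak{S}_n$ is an index $i$ with $2\le i\le n-1$ and $w_{i-1}>w_i>w_{i+1}$; $\mathrm{DDes}(w)$ denotes the set of double descents of $w$. For a finite set $I$ of positive integers, $dd(I;n)=\#\{w\in\mathfrak{S}_n : \mathrm{DDes}(w)=I\}$; in particular $dd(\emptyset;0)=dd(\emptyset;1)=1$. $b_n$ is the number of $w\in\mathfrak{S}_n$ with $\mathrm{DDes}(w)=\emptyset$ and no initial descent, i.e. $w_1<w_2$ when $n\ge 2$; $b_0=b_1=1$. $c(I;n)$ is the number of $w\in\mathfrak{S}_n$ with an initial ascent ($w_1<w_2$) and $\mathrm{DDes}(w)=I$. Conventions: empty sums are $0$; $\binom{n}{j}=0$ if $j<0$ or $j>n$, and any term containing a vanishing binomial coefficient is read as $0$ (even if another factor would have a negative argument). *)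

theory Defs
  imports "HOL-Combinatorics.Combinatorics"
begin

text \<open>
  A permutation of \<open>{1..n}\<close> is represented by its one-line notation: a list in
  \<^term>\<open>permutations_of_set {1..n}\<close>.  Positions are counted from 1, so the entry
  at position \<open>i\<close> of \<open>w\<close> is \<open>w ! (i - 1)\<close>.
\<close>

definition DDes :: "nat list \<Rightarrow> nat set" where
  "DDes w = {i. 2 \<le> i \<and> i + 1 \<le> length w \<and> w ! (i - 2) > w ! (i - 1) \<and> w ! (i - 1) > w ! i}"

definition dd :: "nat set \<Rightarrow> nat \<Rightarrow> nat" where
  "dd I n = card {w \<in> permutations_of_set {1..n}. DDes w = I}"

definition no_init_desc :: "nat list \<Rightarrow> bool" where
  "no_init_desc w \<longleftrightarrow> (2 \<le> length w \<longrightarrow> w ! 0 < w ! 1)"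

text \<open>Unlike \<^const>\<open>no_init_desc\<close>, an initial ascent requires at least two entries.\<close>

definition init_asc :: "nat list \<Rightarrow> bool" where
  "init_asc w \<longleftrightarrow> 2 \<le> length w \<and> w ! 0 < w ! 1"

definition b_num :: "nat \<Rightarrow> nat" where
  "b_num n = card {w \<in> permutations_of_set {1..n}. DDes w = {} \<and> no_init_desc w}"

definition c_num :: "nat set \<Rightarrow> nat \<Rightarrow> nat" where
  "c_num I n = card {w \<in> permutations_of_set {1..n}. init_asc w \<and> DDes w = I}"

end

theory Submission
  imports Defs
begin

text \<open>
  Split a permutation of \<open>{1..n + 1}\<close> at its maximum as \<open>u @ (n + 1) # v\<close> with \<open>length u = k\<close>.
  The maximum is never a double descent and neither is the last entry of \<open>u\<close>; the first entry of \<open>v\<close>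
  is one iff \<open>v\<close> starts with a descent. So the unique double descent \<open>m\<close> lies in \<open>u\<close> (then
  \<open>k > m\<close>), is the first entry of \<open>v\<close> (then \<open>k = m - 2\<close>), or lies further inside \<open>v\<close>, which must
  then start with an ascent, so \<open>m - 1 - k \<ge> 3\<close>. These three cases give the three summands;
  double descents depend only on the relative order, so the choice of the letters of \<open>u\<close>
  contributes a binomial coefficient.
\<close>

section \<open>Predicates of relative order and relabelling of letters\<close>

definition order_invariant :: "(nat list \<Rightarrow> bool) \<Rightarrow> bool" where
  "order_invariant P \<longleftrightarrow> (\<forall>f xs. strict_mono_on (set xs) f \<longrightarrow> P (map f xs) = P xs)"

definition perm_count :: "(nat list \<Rightarrow> bool) \<Rightarrow> nat \<Rightarrow> nat" where
  "perm_count P n = card {w \<in> permutations_of_set {1..n}. P w}"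

lemma order_invariantD: "order_invariant P \<Longrightarrow> strict_mono_on (set xs) f \<Longrightarrow> P (map f xs) = P xs"
  by (simp add: order_invariant_def)

lemma nth_map_less_iff:
  fixes xs :: "nat list" and f :: "nat \<Rightarrow> nat"
  assumes "strict_mono_on (set xs) f" "i < length xs" "j < length xs"
  shows "map f xs ! i < map f xs ! j \<longleftrightarrow> xs ! i < xs ! j"
  using assms strict_mono_on_less[OF assms(1)] by simp

lemma DDes_map_strict_mono:
  assumes "strict_mono_on (set xs) f"
  shows "DDes (map f xs) = DDes xs"
proof -
  have "map f xs ! (i - 2) > map f xs ! (i - 1) \<longleftrightarrow> xs ! (i - 2) > xs ! (i - 1)"
       "map f xs ! (i - 1) > map f xs ! i \<longleftrightarrow> xs ! (i - 1) > xs ! i"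
    if "i + 1 \<le> length xs" for i
    using that by (intro nth_map_less_iff[OF assms]; simp)+
  then show ?thesis unfolding DDes_def by auto
qed

lemma init_asc_map_strict_mono:
  assumes "strict_mono_on (set xs) f"
  shows "init_asc (map f xs) = init_asc xs"
  using strict_mono_on_less[OF assms]
  \<comment> \<open>The rule serves only as a case split: empty list, one entry, at least two
    entries.\<close>
  by (cases xs rule: remdups_adj.cases) (simp_all add: init_asc_def)

lemma no_init_desc_map_strict_mono:
  assumes "strict_mono_on (set xs) f"
  shows "no_init_desc (map f xs) = no_init_desc xs"
  using strict_mono_on_less[OF assms]
  by (cases xs rule: remdups_adj.cases) (simp_all add: no_init_desc_def)

lemma ex_strict_mono_enumeration:
  fixes A :: "nat set"
  assumes "finite A"
  obtains f where "strict_mono_on {1..card A} f" "f ` {1..card A} = A"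
proof -
  let ?xs = "sorted_list_of_set A"
  \<comment> \<open>The shift reconciles the domain, which starts at 1, with list indices, which
    start at 0.\<close>
  define f where "f i = ?xs ! (i - 1)" for i
  have "strict_mono_on {1..card A} f"
    unfolding f_def by (auto intro!: strict_mono_onI sorted_wrt_nth_less[of "(<)"])
  moreover have "f ` {1..card A} = A"
  proof -
    have "{1..card A} = Suc ` {..<card A}"
      by (simp add: image_Suc_lessThan)
    then have "f ` {1..card A} = (!) ?xs ` {..<length ?xs}"
      by (simp add: image_image f_def)
    also have "\<dots> = A"
      using assms nth_image[of "length ?xs" ?xs] by (simp add: lessThan_atLeast0)
    finally show ?thesis .
  qed
  ultimately show ?thesis by (rule that)
qed

text \<open>The increasing bijection from \<open>{1..card A}\<close> onto \<open>A\<close> carries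
  arrangements to arrangements without changing \<open>P\<close>. This standardization makes the
  counts for both factors of a split depend only on their lengths.\<close>

lemma card_permutations_of_set_order_invariant:
  fixes A :: "nat set"
  assumes "finite A" "order_invariant P"
  shows "card {w \<in> permutations_of_set A. P w} = perm_count P (card A)"
proof -
  obtain f where f: "strict_mono_on {1..card A} f" "f ` {1..card A} = A"
    using ex_strict_mono_enumeration[OF assms(1)] .
  have inj: "inj_on f {1..card A}"
    using f(1) strict_mono_on_imp_inj_on by blast
  have "permutations_of_set A = map f ` permutations_of_set {1..card A}"
    using permutations_of_set_image_inj[OF inj] f(2) by simp
  moreover have "P (map f w) = P w" if "w \<in> permutations_of_set {1..card A}" for w
  proof -
    have "set w = {1..card A}"
      using that unfolding permutations_of_set_def by blast
    then show ?thesis using order_invariantD[OF assms(2), of w f] f(1) by metis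
  qed
  ultimately have "{w \<in> permutations_of_set A. P w}
      = map f ` {w \<in> permutations_of_set {1..card A}. P w}"
    by auto
  moreover have "inj_on (map f) {w \<in> permutations_of_set {1..card A}. P w}"
    by (intro inj_on_mapI inj_on_subset[OF inj]) (auto simp: permutations_of_set_def)
  ultimately show ?thesis
    by (simp add: card_image perm_count_def)
qed

section \<open>Splitting at the maximum\<close>

definition split_at_max :: "nat \<Rightarrow> (nat list \<Rightarrow> bool) \<Rightarrow> (nat \<Rightarrow> nat list \<Rightarrow> bool) \<Rightarrow> nat list set" where
  "split_at_max n P R =
    {u @ (n + 1) # v |u v. u @ (n + 1) # v \<in> permutations_of_set {1..n + 1} \<and> P u \<and> R (length u) v}"

lemma finite_split_at_max: "finite (split_at_max n P R)"
  by (rule finite_subset[of _ "permutations_of_set {1..n + 1}"]) (auto simp: split_at_max_def)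

text \<open>Once the letter set of \<open>u\<close> is fixed, \<open>u\<close> and \<open>v\<close>
  can be arranged independently; this form prepares the product count.\<close>

lemma append_max_in_permutations_iff:
  fixes n :: nat
  shows "u @ (n + 1) # v \<in> permutations_of_set {1..n + 1} \<longleftrightarrow>
    set u \<subseteq> {1..n} \<and> u \<in> permutations_of_set (set u) \<and> v \<in> permutations_of_set ({1..n} - set u)"
proof -
  define B where "B = {1..n}"
  have "{1..n + 1} = insert (n + 1) B" "n + 1 \<notin> B"
    by (auto simp: B_def)
  \<comment> \<open>Cancelling the maximum leaves \<open>set u \<union> set v = {1..n}\<close>,
    which with distinctness forces the letters of \<open>v\<close> to be the complement.\<close>
  moreover have "insert x (set u \<union> set v) = insert x B \<longleftrightarrow> set u \<union> set v = B"
    if "x \<notin> set u" "x \<notin> set v" "x \<notin> B" for x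
    using that insert_ident[of x "set u \<union> set v" B] by blast
  ultimately show ?thesis
    unfolding B_def[symmetric] permutations_of_set_def by auto
qed

text \<open>Entries are distinct, so \<open>x\<close> occurs once and its position determines both
  factors.\<close>

lemma append_max_eq_iff:
  assumes "u @ x # v \<in> permutations_of_set A" "u' @ x # v' \<in> permutations_of_set A"
  shows "u @ x # v = u' @ x # v' \<longleftrightarrow> u = u' \<and> v = v'"
  using assms by (auto simp: permutations_of_set_def append_Cons_eq_iff)

lemma split_at_max_disjoint:
  assumes "\<And>u v. P u \<Longrightarrow> R (length u) v \<Longrightarrow> P' u \<Longrightarrow> R' (length u) v \<Longrightarrow> False"
  shows "split_at_max n P R \<inter> split_at_max n P' R' = {}"
proof -
  have False if w_in: "w \<in> split_at_max n P R" "w \<in> split_at_max n P' R'" for w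
  proof -
    obtain u v where w: "w = u @ (n + 1) # v" "w \<in> permutations_of_set {1..n + 1}"
      "P u" "R (length u) v"
      using w_in(1) unfolding split_at_max_def by blast
    obtain u' v' where w': "w = u' @ (n + 1) # v'" "P' u'" "R' (length u') v'"
      using w_in(2) unfolding split_at_max_def by blast
    have "u = u' \<and> v = v'"
      using w(1,2) w'(1) append_max_eq_iff[of u "n + 1" v "{1..n + 1}" u' v'] by simp
    then show False using assms w(3,4) w'(2,3) by blast
  qed
  then show ?thesis by blast
qed

text \<open>Choose the letters of \<open>u\<close>, then arrange \<open>u\<close> and
  \<open>v\<close> independently. By standardization only the number \<open>k\<close> of chosen
  letters matters, and there are \<open>n choose k\<close> choices. The family \<open>R\<close> is
  indexed by \<open>k\<close> because the double descent required in \<open>v\<close> shifts with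
  the position of the maximum.\<close>

lemma card_split_at_max:
  assumes P: "order_invariant P" and R: "\<And>k. order_invariant (R k)"
  shows "card (split_at_max n P R) =
    (\<Sum>k\<le>n. (n choose k) * perm_count P k * perm_count (R k) (n - k))"
proof -
  define U where "U A = {u \<in> permutations_of_set A. P u}" for A :: "nat set"
  define V where "V A = {v \<in> permutations_of_set ({1..n} - A). R (card A) v}" for A :: "nat set"
  \<comment> \<open>Each pair is tagged with the letter set \<open>A\<close> of \<open>u\<close>, so
    that the count becomes a sum over \<open>A\<close>; the tag is recovered as
    \<open>set u\<close>.\<close>
  define T where "T = (SIGMA A:Pow {1..n}. U A \<times> V A)"
  have set_U: "set u = A" "length u = card A" if "u \<in> U A" for u A
    using that by (auto simp: U_def permutations_of_set_def distinct_card)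
  have mem: "u @ (n + 1) # v \<in> permutations_of_set {1..n + 1}"
    if "A \<subseteq> {1..n}" "u \<in> U A" "v \<in> V A" for A u v
    using that set_U[OF that(2)] unfolding append_max_in_permutations_iff by (auto simp: U_def V_def)
  have "bij_betw (\<lambda>(A, u, v). u @ (n + 1) # v) T (split_at_max n P R)"
  proof (rule bij_betw_imageI)
    show "inj_on (\<lambda>(A, u, v). u @ (n + 1) # v) T"
    proof (rule inj_onI, unfold split_paired_all prod.case)
      fix A u v A' u' v'
      assume in_T: "(A, u, v) \<in> T" "(A', u', v') \<in> T"
        and eq: "u @ (n + 1) # v = u' @ (n + 1) # v'"
      then have "u @ (n + 1) # v \<in> permutations_of_set {1..n + 1}"
        "u' @ (n + 1) # v' \<in> permutations_of_set {1..n + 1}"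
        unfolding T_def by (blast intro: mem)+
      then have "u = u' \<and> v = v'"
        using eq append_max_eq_iff[of u "n + 1" v "{1..n + 1}" u' v'] by simp
      moreover have "set u = A" "set u' = A'"
        using in_T by (simp_all add: T_def set_U(1))
      ultimately show "(A, u, v) = (A', u', v')" by blast
    qed
    show "(\<lambda>(A, u, v). u @ (n + 1) # v) ` T = split_at_max n P R"
    proof (intro equalityI subsetI)
      fix w assume "w \<in> (\<lambda>(A, u, v). u @ (n + 1) # v) ` T"
      then obtain A u v where w: "w = u @ (n + 1) # v" "A \<subseteq> {1..n}" "u \<in> U A" "v \<in> V A"
        by (auto simp: T_def)
      have "P u" "R (length u) v"
        using w(3,4) set_U(2)[OF w(3)] by (auto simp: U_def V_def)
      then show "w \<in> split_at_max n P R"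
        using mem[OF w(2-4)] w(1) unfolding split_at_max_def by blast
    next
      fix w assume "w \<in> split_at_max n P R"
      then obtain u v where w: "w = u @ (n + 1) # v" "w \<in> permutations_of_set {1..n + 1}"
        "P u" "R (length u) v" unfolding split_at_max_def by blast
      note * = w(2)[unfolded w(1) append_max_in_permutations_iff]
      have "card (set u) = length u"
        using * by (auto simp: permutations_of_set_def distinct_card)
      with * w(3,4) have "(set u, u, v) \<in> T"
        by (auto simp: T_def U_def V_def)
      then show "w \<in> (\<lambda>(A, u, v). u @ (n + 1) # v) ` T"
        unfolding w(1) by (rule rev_image_eqI) simp
    qed
  qed
  then have "card (split_at_max n P R) = card T"
    by (simp add: bij_betw_same_card)
  also have "\<dots> = (\<Sum>A\<in>Pow {1..n}. card (U A) * card (V A))"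
    unfolding T_def by (subst card_SigmaI) (auto simp: U_def V_def card_cartesian_product)
  also have "\<dots> = (\<Sum>A\<in>Pow {1..n}. perm_count P (card A) * perm_count (R (card A)) (n - card A))"
  proof (rule sum.cong[OF refl])
    fix A assume "A \<in> Pow {1..n}"
    then have "A \<subseteq> {1..n}" by blast
    then have A: "finite A" "card ({1..n} - A) = n - card A"
      using finite_subset[of A "{1..n}"] by (simp_all add: card_Diff_subset)
    show "card (U A) * card (V A) = perm_count P (card A) * perm_count (R (card A)) (n - card A)"
      unfolding U_def V_def using A P R by (simp add: card_permutations_of_set_order_invariant)
  qed
  also have "\<dots> = (\<Sum>k\<le>n. \<Sum>A | A \<in> Pow {1..n} \<and> card A = k.
      perm_count P (card A) * perm_count (R (card A)) (n - card A))"
  proof (rule sum.group[symmetric])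
    show "card ` Pow {1..n} \<subseteq> {..n}"
      using card_mono[of "{1..n}"] by fastforce
  qed simp_all
  also have "\<dots> = (\<Sum>k\<le>n. (n choose k) * perm_count P k * perm_count (R k) (n - k))"
  proof (rule sum.cong[OF refl])
    fix k
    have "(\<Sum>A | A \<in> Pow {1..n} \<and> card A = k.
        perm_count P (card A) * perm_count (R (card A)) (n - card A))
      = (\<Sum>A | A \<in> Pow {1..n} \<and> card A = k. perm_count P k * perm_count (R k) (n - k))"
      by (rule sum.cong) auto
    then show "(\<Sum>A | A \<in> Pow {1..n} \<and> card A = k.
        perm_count P (card A) * perm_count (R (card A)) (n - card A))
      = (n choose k) * perm_count P k * perm_count (R k) (n - k)"
      by (simp add: n_subsets)
  qed
  finally show ?thesis .
qed

section \<open>Double descents of a split word\<close>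

lemma DDes_append_max:
  assumes "\<forall>x\<in>set u. x < M" "\<forall>x\<in>set v. x < M" "distinct v"
  shows "DDes (u @ M # v) = DDes u \<union> (if no_init_desc v then {} else {length u + 2})
    \<union> (\<lambda>i. length u + 1 + i) ` DDes v" (is "?L = ?R")
proof (rule set_eqI)
  fix i
  let ?k = "length u" and ?w = "u @ M # v"
  \<comment> \<open>The cases follow the position \<open>i\<close> of the middle entry: before the
    last entry of \<open>u\<close>, at that entry, at \<open>M\<close>, at the first entry of
    \<open>v\<close>, or later in \<open>v\<close>. Since \<open>M\<close> has position
    \<open>?k + 1\<close>, position \<open>j\<close> of \<open>v\<close> becomes
    \<open>?k + 1 + j\<close>.\<close>
  consider "i < ?k" | "i = ?k" | "i = ?k + 1" | "i = ?k + 2" | j where "i = ?k + 1 + j" "2 \<le> j"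
  proof -
    have "i < ?k \<or> i = ?k \<or> i = ?k + 1 \<or> i = ?k + 2 \<or> (i = ?k + 1 + (i - ?k - 1) \<and> 2 \<le> i - ?k - 1)"
      by linarith
    then show ?thesis using that by blast
  qed
  then show "i \<in> ?L \<longleftrightarrow> i \<in> ?R"
  proof cases
    case 1
    then have "?w ! (i - 2) = u ! (i - 2)" "?w ! (i - 1) = u ! (i - 1)" "?w ! i = u ! i"
      by (simp_all add: nth_append less_imp_diff_less)
    with 1 show ?thesis by (auto simp: DDes_def)
  next
    case 2
    have "u ! (?k - 1) < M" if "2 \<le> ?k"
      using assms(1) that by auto
    then have "i \<notin> ?L" using 2 by (auto simp: DDes_def nth_append)
    with 2 show ?thesis by (auto simp: DDes_def)
  next
    case 3
    have "u ! (?k - 1) < M" if "2 \<le> i"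
      using assms(1) 3 that by (cases "u = []") auto
    then have "i \<notin> ?L" using 3 by (auto simp: DDes_def nth_append)
    with 3 show ?thesis by (auto simp: DDes_def)
  next
    case 4
    then have "i \<in> ?L \<longleftrightarrow> 2 \<le> length v \<and> v ! 0 < M \<and> v ! 1 < v ! 0"
      by (auto simp: DDes_def nth_append)
    \<comment> \<open>The descent from \<open>M\<close> is automatic, and distinctness turns the
      failure of an ascent into a strict descent.\<close>
    also have "\<dots> \<longleftrightarrow> \<not> no_init_desc v"
      using assms(2,3) by (cases v rule: remdups_adj.cases) (auto simp: no_init_desc_def)
    also have "\<dots> \<longleftrightarrow> i \<in> ?R"
      using 4 by (auto simp: DDes_def)
    finally show ?thesis .
  next
    case (5 j)
    \<comment> \<open>This form makes the truncated subtractions in the indices exact.\<close>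
    then obtain l where "j = Suc (Suc l)" by (auto simp: numeral_2_eq_2 Suc_le_eq elim: lessE)
    then have "?w ! (i - 2) = v ! (j - 2)" "?w ! (i - 1) = v ! (j - 1)" "?w ! i = v ! j"
      using 5(1) by (simp_all add: nth_append)
    with 5 show ?thesis by (auto simp: DDes_def no_init_desc_def)
  qed
qed

section \<open>The counting functions and the possible positions of double descents\<close>

lemma dd_eq_perm_count: "dd I n = perm_count (\<lambda>w. DDes w = I) n"
  by (simp add: dd_def perm_count_def)

lemma b_num_eq_perm_count: "b_num n = perm_count (\<lambda>w. no_init_desc w \<and> DDes w = {}) n"
  unfolding b_num_def perm_count_def by (rule arg_cong[of _ _ card]) blast

text \<open>Identifies the factor \<open>dd - b\<close> of the second summand as the count of
  permutations that start with a descent but have no double descent; the additive form avoids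
  truncated subtraction.\<close>

lemma dd_eq_b_num_plus:
  "dd {} n = b_num n + perm_count (\<lambda>w. \<not> no_init_desc w \<and> DDes w = {}) n"
proof -
  let ?S = "permutations_of_set {1..n}"
  have *: "{w \<in> ?S. DDes w = {}} = {w \<in> ?S. DDes w = {} \<and> no_init_desc w}
      \<union> {w \<in> ?S. \<not> no_init_desc w \<and> DDes w = {}}"
    by blast
  show ?thesis
    unfolding dd_def b_num_def perm_count_def *
    by (rule card_Un_disjoint) (simp, simp, blast)
qed

lemma DDes_bounds: "i \<in> DDes w \<Longrightarrow> 2 \<le> i \<and> i < length w"
  by (simp add: DDes_def)

text \<open>A double descent needs an entry to its right. This lets the first sum start at
  \<open>m + 1\<close>.\<close>

lemma dd_singleton_eq_0:
  assumes "n \<le> m"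
  shows "dd {m} n = 0"
proof -
  have "DDes w \<noteq> {m}" if "w \<in> permutations_of_set {1..n}" for w
  proof -
    have "length w = n" using length_finite_permutations_of_set[OF that] by simp
    then have "m \<notin> DDes w" using assms DDes_bounds[of m w] by linarith
    then show ?thesis by blast
  qed
  then show ?thesis by (auto simp: dd_def)
qed

text \<open>The two notions differ only on words with fewer than two entries, which have no double
  descent. This is the passage from \<open>no_init_desc\<close> to the condition counted by
  \<open>c_num\<close>.\<close>

lemma no_init_desc_nonempty_DDes_iff:
  assumes "DDes w \<noteq> {}"
  shows "no_init_desc w \<longleftrightarrow> init_asc w"
proof -
  obtain i where "i \<in> DDes w" using assms by blast
  then have "2 \<le> length w" using DDes_bounds[of i w] by linarith
  then show ?thesis by (simp add: no_init_desc_def init_asc_def)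
qed

lemma init_asc_DDes_bound: "init_asc w \<Longrightarrow> i \<in> DDes w \<Longrightarrow> 3 \<le> i"
  by (cases "i = 2") (simp_all add: init_asc_def DDes_def)

text \<open>The three parts of the union in \<open>DDes_append_max\<close> lie below
  \<open>length u\<close>, at \<open>length u + 2\<close>, and from \<open>length u + 3\<close> on,
  so exactly one of them is nonempty. In the last case an initial ascent pushes the first possible
  double descent of \<open>v\<close> to 3, whence \<open>length u + 4 \<le> m\<close>.\<close>

lemma singleton_DDes_append_max_iff:
  assumes "\<forall>x\<in>set u. x < M" "\<forall>x\<in>set v. x < M" "distinct v"
  shows "DDes (u @ M # v) = {m} \<longleftrightarrow>
      (DDes u = {m} \<and> no_init_desc v \<and> DDes v = {}) \<or>
      (DDes u = {} \<and> length u + 2 = m \<and> \<not> no_init_desc v \<and> DDes v = {}) \<or>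
      (DDes u = {} \<and> length u + 4 \<le> m \<and> init_asc v \<and> DDes v = {m - 1 - length u})"
    (is "?L \<longleftrightarrow> ?R")
proof
  assume L: ?L
  have bu: "i < length u" if "i \<in> DDes u" for i using that DDes_bounds by blast
  have bv: "2 \<le> i" if "i \<in> DDes v" for i using that DDes_bounds by blast
  note D = DDes_append_max[OF assms]
  let ?k = "length u"
  have sub: "DDes u \<subseteq> {m}" "(\<lambda>i. ?k + 1 + i) ` DDes v \<subseteq> {m}"
    using L D by auto
  show ?R
  proof (cases "DDes v = {}")
    case True
    then show ?thesis using L D bu[of m] by (cases "no_init_desc v") force+
  next
    case False
    then obtain j where j: "j \<in> DDes v" by blast
    have m: "m = ?k + 1 + j" using sub(2) j by auto
    have v: "DDes v = {j}" using sub(2) j m by auto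
    have "DDes u = {}" using sub(1) bu[of m] m by auto
    \<comment> \<open>An initial descent would contribute \<open>?k + 2\<close>, but
      \<open>m = ?k + 1 + j\<close> is at least \<open>?k + 3\<close>.\<close>
    moreover have "no_init_desc v"
      using L D bv[OF j] m by (auto split: if_splits)
    then have "init_asc v" using no_init_desc_nonempty_DDes_iff False by blast
    moreover have "3 \<le> j" using init_asc_DDes_bound[OF \<open>init_asc v\<close> j] .
    ultimately show ?thesis using m v by auto
  qed
next
  assume ?R
  then show ?L
    unfolding DDes_append_max[OF assms]
    by (elim disjE) (auto simp: init_asc_def no_init_desc_def)
qed

section \<open>The three classes and their summands\<close>

lemma dd_singleton_eq_card_split:
  fixes m n :: nat
  defines "S1 \<equiv> split_at_max n (\<lambda>u. DDes u = {m}) (\<lambda>k v. no_init_desc v \<and> DDes v = {})"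
    and "S2 \<equiv> split_at_max n (\<lambda>u. DDes u = {}) (\<lambda>k v. k + 2 = m \<and> \<not> no_init_desc v \<and> DDes v = {})"
    and "S3 \<equiv> split_at_max n (\<lambda>u. DDes u = {}) (\<lambda>k v. k + 4 \<le> m \<and> init_asc v \<and> DDes v = {m - 1 - k})"
  shows "dd {m} (n + 1) = card S1 + card S2 + card S3"
proof -
  let ?S = "permutations_of_set {1..n + 1}"
  have eq: "DDes (u @ (n + 1) # v) = {m} \<longleftrightarrow>
      (DDes u = {m} \<and> no_init_desc v \<and> DDes v = {}) \<or>
      (DDes u = {} \<and> length u + 2 = m \<and> \<not> no_init_desc v \<and> DDes v = {}) \<or>
      (DDes u = {} \<and> length u + 4 \<le> m \<and> init_asc v \<and> DDes v = {m - 1 - length u})"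
    if "u @ (n + 1) # v \<in> ?S" for u v
    using that unfolding append_max_in_permutations_iff
    by (intro singleton_DDes_append_max_iff) (auto simp: permutations_of_set_def)
  have "{w \<in> ?S. DDes w = {m}} = S1 \<union> S2 \<union> S3"
  proof (intro equalityI subsetI)
    fix w assume w: "w \<in> {w \<in> ?S. DDes w = {m}}"
    then have "n + 1 \<in> set w" by (auto simp: permutations_of_set_def)
    then obtain u v where uv: "w = u @ (n + 1) # v" by (auto dest: split_list)
    show "w \<in> S1 \<union> S2 \<union> S3"
      using w eq[of u v] unfolding uv S1_def S2_def S3_def split_at_max_def by blast
  next
    fix w assume "w \<in> S1 \<union> S2 \<union> S3"
    then show "w \<in> {w \<in> ?S. DDes w = {m}}"
      using eq unfolding S1_def S2_def S3_def split_at_max_def by blast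
  qed
  \<comment> \<open>\<open>S1\<close> is told apart from the others by \<open>DDes u\<close>, and
    \<open>S2\<close> from \<open>S3\<close> by the length of \<open>u\<close>.\<close>
  moreover have "S1 \<inter> S2 = {}"
    unfolding S1_def S2_def by (rule split_at_max_disjoint) simp
  moreover have "S1 \<inter> S3 = {}"
    unfolding S1_def S3_def by (rule split_at_max_disjoint) simp
  moreover have "S2 \<inter> S3 = {}"
    unfolding S2_def S3_def by (rule split_at_max_disjoint) simp
  moreover have "finite S1" "finite S2" "finite S3"
    by (simp_all add: S1_def S2_def S3_def finite_split_at_max)
  ultimately show ?thesis
    by (simp add: dd_def card_Un_disjoint Un_assoc Int_Un_distrib)
qed

lemmas order_invariant_simps = order_invariant_def DDes_map_strict_mono
  init_asc_map_strict_mono no_init_desc_map_strict_mono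

lemma card_split_dd_before_max:
  fixes m n :: nat
  shows "card (split_at_max n (\<lambda>u. DDes u = {m}) (\<lambda>k v. no_init_desc v \<and> DDes v = {}))
    = (\<Sum>k = m + 1..n. (n choose k) * dd {m} k * b_num (n - k))"
proof -
  have "card (split_at_max n (\<lambda>u. DDes u = {m}) (\<lambda>k v. no_init_desc v \<and> DDes v = {}))
      = (\<Sum>k\<le>n. (n choose k) * dd {m} k * b_num (n - k))"
    unfolding dd_eq_perm_count b_num_eq_perm_count
    by (rule card_split_at_max) (simp_all add: order_invariant_simps)
  also have "\<dots> = (\<Sum>k = m + 1..n. (n choose k) * dd {m} k * b_num (n - k))"
    by (rule sum.mono_neutral_right) (auto simp: dd_singleton_eq_0)
  finally show ?thesis .
qed

lemma card_split_dd_right_after_max: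
  fixes m n :: nat
  shows "card (split_at_max n (\<lambda>u. DDes u = {})
      (\<lambda>k v. k + 2 = m \<and> \<not> no_init_desc v \<and> DDes v = {}))
    = (if m \<ge> 2 then (n choose (m - 2)) * dd {} (m - 2) *
          perm_count (\<lambda>w. \<not> no_init_desc w \<and> DDes w = {}) (n + 2 - m) else 0)"
proof -
  let ?e = "perm_count (\<lambda>w. \<not> no_init_desc w \<and> DDes w = {})"
  have "card (split_at_max n (\<lambda>u. DDes u = {})
        (\<lambda>k v. k + 2 = m \<and> \<not> no_init_desc v \<and> DDes v = {}))
      = (\<Sum>k\<le>n. (n choose k) * dd {} k *
          perm_count (\<lambda>v. k + 2 = m \<and> \<not> no_init_desc v \<and> DDes v = {}) (n - k))"
    unfolding dd_eq_perm_count
    by (rule card_split_at_max) (simp_all add: order_invariant_simps)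
  \<comment> \<open>The condition on \<open>k\<close> does not involve \<open>v\<close>, so it
    leaves the count unchanged or makes it 0.\<close>
  also have "\<dots> = (\<Sum>k\<le>n. if k + 2 = m then (n choose k) * dd {} k * ?e (n - k) else 0)"
    by (rule sum.cong) (auto simp: perm_count_def)
  also have "\<dots> = (\<Sum>k | k \<le> n \<and> k + 2 = m. (n choose k) * dd {} k * ?e (n - k))"
    by (simp add: sum.inter_filter[symmetric])
  \<comment> \<open>For \<open>m > n + 2\<close> the set is empty, in agreement with the vanishing
    binomial coefficient in the claim.\<close>
  also have "{k. k \<le> n \<and> k + 2 = m} = (if 2 \<le> m \<and> m \<le> n + 2 then {m - 2} else {})"
    by auto
  finally show ?thesis by (auto simp: binomial_eq_0)
qed

text \<open>The range is written \<open>k + 4 \<le> m\<close> because the truncated bound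
  \<open>k \<le> m - 4\<close> would admit \<open>k = 0\<close> for \<open>m < 4\<close>.\<close>

lemma card_split_dd_after_max:
  fixes m n :: nat
  shows "card (split_at_max n (\<lambda>u. DDes u = {})
      (\<lambda>k v. k + 4 \<le> m \<and> init_asc v \<and> DDes v = {m - 1 - k}))
    = (\<Sum>k | k + 4 \<le> m. (n choose k) * dd {} k * c_num {m - 1 - k} (n - k))"
proof -
  have fin: "finite {k. k + 4 \<le> m}"
    by (rule finite_subset[of _ "{..m}"]) auto
  have "card (split_at_max n (\<lambda>u. DDes u = {})
        (\<lambda>k v. k + 4 \<le> m \<and> init_asc v \<and> DDes v = {m - 1 - k}))
      = (\<Sum>k\<le>n. (n choose k) * dd {} k *
          perm_count (\<lambda>v. k + 4 \<le> m \<and> init_asc v \<and> DDes v = {m - 1 - k}) (n - k))"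
    unfolding dd_eq_perm_count
    by (rule card_split_at_max) (simp_all add: order_invariant_simps)
  also have "\<dots> = (\<Sum>k\<le>n. if k + 4 \<le> m
      then (n choose k) * dd {} k * c_num {m - 1 - k} (n - k) else 0)"
    by (rule sum.cong) (auto simp: perm_count_def c_num_def)
  also have "\<dots> = (\<Sum>k | k \<le> n \<and> k + 4 \<le> m.
      (n choose k) * dd {} k * c_num {m - 1 - k} (n - k))"
    by (simp add: sum.inter_filter[symmetric])
  also have "\<dots> = (\<Sum>k | k + 4 \<le> m. (n choose k) * dd {} k * c_num {m - 1 - k} (n - k))"
    \<comment> \<open>Terms with \<open>k > n\<close> may be added: their binomial coefficient is 0,
      whatever the value at the truncated \<open>n - k\<close>.\<close>
    using fin by (intro sum.mono_neutral_left) (auto simp: binomial_eq_0)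
  finally show ?thesis .
qed

theorem theorem3p1:
  fixes m n :: nat and I :: "nat set"
  assumes "m \<ge> 1" and "n \<ge> 1" and "I = {m}"
  shows "int (dd I (n + 1)) =
      (\<Sum>k = m + 1..n. int (n choose k) * int (dd I k) * int (b_num (n - k)))
    + (if m \<ge> 2 then int (n choose (m - 2)) * int (dd {} (m - 2))
          * (int (dd {} (n + 2 - m)) - int (b_num (n + 2 - m))) else 0)
    + (\<Sum>k | k + 4 \<le> m. int (n choose k) * int (dd {} k) * int (c_num {m - 1 - k} (n - k)))"
proof -
  let ?e = "perm_count (\<lambda>w. \<not> no_init_desc w \<and> DDes w = {})"
  \<comment> \<open>Read from right to left, this replaces the integer difference by a natural
    number, so the claim becomes the image of an identity between natural numbers.\<close>
  have e: "int (?e k) = int (dd {} k) - int (b_num k)" for k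
    by (simp add: dd_eq_b_num_plus)
  show ?thesis
    unfolding assms(3) dd_singleton_eq_card_split card_split_dd_before_max
      card_split_dd_right_after_max card_split_dd_after_max e[symmetric] by simp
qed

end
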